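(* Let $T>0$, $\nu>0$, let $A,B$ be real $n\times n$ matrices and let $x_0\in\mathbb{R}^n$. Put $\gamma=\|A\|+\nu\|B\|$. Then for every admissible control $u(\cdot)$, i.e. every piecewise continuous $u:[0,T]\to\mathbb{R}$ with $|u(t)|\le\nu$ for all $t\in[0,T]$, the corresponding trajectory $x(\cdot)$, i.e. the solution on $[0,T]$ of $$\dot x(t)=(A+u(t)B)\,x(t),\qquad x(0)=x_0,$$ satisfies for all $t\in[0,T]$ $$\|x_0\|e^{-\gamma T}\le\|x(t)\|\le\|x_0\|e^{\gamma T}.$$
   Context: For a vector $x\in\mathbb{R}^n$, $\|x\|=(x,x)^{1/2}$ is the Euclidean norm with $(x,y)=\sum_i x^iy^i$. For a matrix $A=(a_{ij})$, $\|A\|=\big[\sum_{i,j}a_{ij}^2\big]^{1/2}$ is the Euclidean (Frobenius) norm. Solutions are understood in the classical sense: the trajectory $x(\cdot)$ is continuous on $[0,T]$ with piecewise continuous derivative, and satisfies the differential equation at all points of $[0,T]$ except the finitely many discontinuity points of the control. *)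

theory Defs
  imports "HOL-Analysis.Analysis"
begin

text \<open>
  Vectors are elements of \<open>real ^ 'n\<close> and matrices elements of \<open>real ^ 'n ^ 'n\<close>.  The norm that the
  library puts on both types is the one meant here: on vectors it is the Euclidean norm and on
  matrices the Frobenius norm (not the operator norm), as the next two facts record.
\<close>

lemma norm_vector_eq_euclidean:
  fixes x :: "real ^ 'n"
  shows "norm x = sqrt (\<Sum>i\<in>UNIV. x $ i * x $ i)"
  by (simp add: norm_vec_def L2_set_def power2_eq_square)

lemma norm_matrix_eq_frobenius:
  fixes A :: "real ^ 'n ^ 'm"
  shows "norm A = sqrt (\<Sum>i\<in>UNIV. \<Sum>j\<in>UNIV. (A $ i $ j)\<^sup>2)"
  by (simp add: norm_vec_def L2_set_def sum_nonneg)

text \<open>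
  Piecewise continuity in the usual sense: finitely many discontinuities in \<open>{a..b}\<close>, all of them
  of the first kind.  Only the values of \<open>f\<close> on \<open>{a..b}\<close> matter.
\<close>

definition piecewise_continuous_on ::
    "real \<Rightarrow> real \<Rightarrow> (real \<Rightarrow> 'a::real_normed_vector) \<Rightarrow> bool" where
  "piecewise_continuous_on a b f \<longleftrightarrow>
     finite {t \<in> {a..b}. \<not> continuous (at t within {a..b}) f} \<and>
     (\<forall>t\<in>{a..<b}. \<exists>l. (f \<longlongrightarrow> l) (at_right t)) \<and>
     (\<forall>t\<in>{a<..b}. \<exists>l. (f \<longlongrightarrow> l) (at_left t))"

definition admissible_control :: "real \<Rightarrow> real \<Rightarrow> (real \<Rightarrow> real) \<Rightarrow> bool" where
  "admissible_control T \<nu> u \<longleftrightarrow>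
     piecewise_continuous_on 0 T u \<and> (\<forall>t\<in>{0..T}. \<bar>u t\<bar> \<le> \<nu>)"

text \<open>
  The derivative of \<open>x\<close> need only exist outside a finite set \<open>S\<close>, while the representative \<open>x'\<close> of it
  is a total function whose values on \<open>S\<close> are irrelevant.  Derivatives at the endpoints of
  \<open>{a..b}\<close> are one-sided.
\<close>

definition has_piecewise_continuous_derivative_on ::
    "real \<Rightarrow> real \<Rightarrow> (real \<Rightarrow> 'a::real_normed_vector) \<Rightarrow> bool" where
  "has_piecewise_continuous_derivative_on a b x \<longleftrightarrow>
     (\<exists>x' S. finite S \<and> piecewise_continuous_on a b x' \<and>
        (\<forall>t\<in>{a..b} - S. (x has_vector_derivative x' t) (at t within {a..b})))"

definition trajectory ::
    "real \<Rightarrow> real ^ 'n ^ 'n \<Rightarrow> real ^ 'n ^ 'n \<Rightarrow> (real \<Rightarrow> real) \<Rightarrow> real ^ 'n \<Rightarrow>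
     (real \<Rightarrow> real ^ 'n) \<Rightarrow> bool" where
  "trajectory T A B u x0 x \<longleftrightarrow>
     continuous_on {0..T} x \<and>
     has_piecewise_continuous_derivative_on 0 T x \<and>
     x 0 = x0 \<and>
     (\<forall>t\<in>{0..T}. continuous (at t within {0..T}) u \<longrightarrow>
        (x has_vector_derivative (A + u t *\<^sub>R B) *v x t) (at t within {0..T}))"

end

theory Submission
  imports Defs
begin

text \<open>
  The right-hand side of the equation is linear in the state with coefficient matrix of norm at most
  \<open>\<gamma>\<close>: the Frobenius norm dominates the Euclidean operator norm
  (\<open>norm_matrix_vector_mult_le\<close>), so \<open>norm (x' t) \<le> \<gamma> * norm (x t)\<close> wherever the control is
  continuous.  By Cauchy--Schwarz, the squared norm of the trajectory, which unlike the norm is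
  differentiable also where the trajectory vanishes, has a derivative between
  \<open>- 2 * \<gamma> * (norm (x t))\<^sup>2\<close> and \<open>2 * \<gamma> * (norm (x t))\<^sup>2\<close>.  Hence
  \<open>exp (2 * \<gamma> * t) * (norm (x t))\<^sup>2\<close> is nondecreasing and \<open>exp (- 2 * \<gamma> * t) * (norm (x t))\<^sup>2\<close> is
  nonincreasing; comparing the values at \<open>0\<close> and \<open>t\<close> gives both bounds, with \<open>t\<close> in place of \<open>T\<close>
  (\<open>norm_exp_bounds\<close>).  The finitely many switching points of the control do no harm, because the
  fundamental theorem of calculus for a continuous function tolerates a finite exceptional set
  (\<open>nondecreasing_off_finite\<close>).
\<close>

text \<open>
  Each component of the product is the inner product of a row with the vector, so this is
  Cauchy--Schwarz in every row, followed by summation of the squares over the rows.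
\<close>

lemma norm_matrix_vector_mult_le:
  fixes M :: "real ^ 'n ^ 'm" and v :: "real ^ 'n"
  shows "norm (M *v v) \<le> norm M * norm v"
proof -
  have "norm (M *v v) = L2_set (\<lambda>i. norm (M $ i \<bullet> v)) UNIV"
    by (simp add: norm_vec_def matrix_mult_dot)
  also have "\<dots> \<le> L2_set (\<lambda>i. norm (M $ i) * norm v) UNIV"
    by (rule L2_set_mono) (auto simp: Cauchy_Schwarz_ineq2)
  also have "\<dots> = norm M * norm v"
    by (simp add: norm_vec_def[of M] L2_set_left_distrib)
  finally show ?thesis .
qed

lemma nondecreasing_off_finite:
  fixes g g' :: "real \<Rightarrow> real"
  assumes "a \<le> b" and "finite S" and "continuous_on {a..b} g"
    and deriv: "\<And>t. t \<in> {a<..<b} - S \<Longrightarrow> (g has_vector_derivative g' t) (at t)"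
    and nonneg: "\<And>t. t \<in> {a<..<b} - S \<Longrightarrow> 0 \<le> g' t"
  shows "g a \<le> g b"
proof -
  \<comment> \<open>The integrand may take any value on the exceptional set; the value zero makes it nonnegative.\<close>
  define h where "h t = (if t \<in> {a<..<b} - S then g' t else 0)" for t
  have "(h has_integral (g b - g a)) {a..b}"
    by (rule fundamental_theorem_of_calculus_interior_strong[OF \<open>finite S\<close> \<open>a \<le> b\<close>])
      (use assms in \<open>auto simp: h_def\<close>)
  moreover have "0 \<le> h t" for t
    by (simp add: h_def nonneg)
  ultimately show ?thesis
    using has_integral_nonneg[of h "g b - g a" "{a..b}"] by simp
qed

text \<open>
  Gronwall's inequality in both time directions.  Weighting the squared norm by \<open>exp (c * s)\<close> with
  \<open>c = 2 * \<gamma>\<close> or \<open>c = - 2 * \<gamma>\<close> makes it monotone.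
\<close>

lemma norm_exp_bounds:
  fixes x x' :: "real \<Rightarrow> 'a::real_inner"
  assumes "0 \<le> t" and "finite S" and cont: "continuous_on {0..t} x"
    and deriv: "\<And>s. s \<in> {0<..<t} - S \<Longrightarrow> (x has_vector_derivative x' s) (at s)"
    and growth: "\<And>s. s \<in> {0<..<t} - S \<Longrightarrow> norm (x' s) \<le> \<gamma> * norm (x s)"
  shows "norm (x 0) * exp (- \<gamma> * t) \<le> norm (x t)" and "norm (x t) \<le> norm (x 0) * exp (\<gamma> * t)"
proof -
  define w where "w c s = exp (c * s) * (x s \<bullet> x s)" for c s
  define w' where "w' c s = exp (c * s) * (c * (x s \<bullet> x s) + 2 * (x s \<bullet> x' s))" for c s
  have w_cont: "continuous_on {0..t} (w c)" for c
    unfolding w_def by (intro continuous_intros cont)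
  have w_deriv: "(w c has_vector_derivative w' c s) (at s)" if "s \<in> {0<..<t} - S" for c s
  proof -
    have "((\<lambda>s. x s \<bullet> x s) has_vector_derivative (x s \<bullet> x' s + x' s \<bullet> x s)) (at s)"
      by (rule bounded_bilinear.has_vector_derivative
          [OF bounded_bilinear_inner deriv[OF that] deriv[OF that]])
    then have "((\<lambda>s. x s \<bullet> x s) has_real_derivative 2 * (x s \<bullet> x' s)) (at s)"
      by (simp add: has_real_derivative_iff_has_vector_derivative inner_commute)
    then have "(w c has_real_derivative w' c s) (at s)"
      unfolding w_def w'_def by (auto intro!: derivative_eq_intros simp: algebra_simps)
    then show ?thesis
      by (simp add: has_real_derivative_iff_has_vector_derivative)
  qed
  have inner_bound: "\<bar>x s \<bullet> x' s\<bar> \<le> \<gamma> * (x s \<bullet> x s)" if "s \<in> {0<..<t} - S" for s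
  proof -
    have "\<bar>x s \<bullet> x' s\<bar> \<le> norm (x s) * norm (x' s)"
      by (rule Cauchy_Schwarz_ineq2)
    also have "\<dots> \<le> norm (x s) * (\<gamma> * norm (x s))"
      by (intro mult_left_mono growth that) simp
    finally show ?thesis
      by (simp add: dot_square_norm power2_eq_square mult_ac)
  qed
  have "w (2 * \<gamma>) 0 \<le> w (2 * \<gamma>) t"
  proof (rule nondecreasing_off_finite[OF \<open>0 \<le> t\<close> \<open>finite S\<close> w_cont w_deriv])
    show "0 \<le> w' (2 * \<gamma>) s" if "s \<in> {0<..<t} - S" for s
      using inner_bound[OF that] unfolding w'_def by (intro mult_nonneg_nonneg) auto
  qed
  then have "(norm (x 0))\<^sup>2 \<le> (exp (\<gamma> * t) * norm (x t))\<^sup>2"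
    using exp_double[of "\<gamma> * t"] by (simp add: w_def dot_square_norm power_mult_distrib mult.assoc)
  then have "norm (x 0) \<le> exp (\<gamma> * t) * norm (x t)"
    by (rule power2_le_imp_le) simp
  then show "norm (x 0) * exp (- \<gamma> * t) \<le> norm (x t)"
    by (simp add: exp_minus field_simps)
  have "- w (- 2 * \<gamma>) 0 \<le> - w (- 2 * \<gamma>) t"
  proof (rule nondecreasing_off_finite[OF \<open>0 \<le> t\<close> \<open>finite S\<close>])
    show "continuous_on {0..t} (\<lambda>s. - w (- 2 * \<gamma>) s)"
      by (intro continuous_intros w_cont)
    show "((\<lambda>s. - w (- 2 * \<gamma>) s) has_vector_derivative - w' (- 2 * \<gamma>) s) (at s)"
      if "s \<in> {0<..<t} - S" for s
      by (intro has_vector_derivative_minus w_deriv that)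
    show "0 \<le> - w' (- 2 * \<gamma>) s" if "s \<in> {0<..<t} - S" for s
      using inner_bound[OF that] unfolding w'_def
      by (simp add: mult_nonneg_nonpos)
  qed
  then have "(exp (- \<gamma> * t) * norm (x t))\<^sup>2 \<le> (norm (x 0))\<^sup>2"
    using exp_double[of "- \<gamma> * t"] by (simp add: w_def dot_square_norm power_mult_distrib mult.assoc)
  then have "exp (- \<gamma> * t) * norm (x t) \<le> norm (x 0)"
    by (rule power2_le_imp_le) simp
  then show "norm (x t) \<le> norm (x 0) * exp (\<gamma> * t)"
    by (simp add: exp_minus field_simps)
qed

theorem theorem1:
  fixes T \<nu> \<gamma> :: real
    and A B :: "real ^ 'n ^ 'n"
    and x0 :: "real ^ 'n"
    and u :: "real \<Rightarrow> real"
    and x :: "real \<Rightarrow> real ^ 'n"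
  assumes "T > 0" and "\<nu> > 0"
    and "\<gamma> = norm A + \<nu> * norm B"
    and "admissible_control T \<nu> u"
    and "trajectory T A B u x0 x"
  shows "\<forall>t\<in>{0..T}. norm x0 * exp (- \<gamma> * T) \<le> norm (x t) \<and> norm (x t) \<le> norm x0 * exp (\<gamma> * T)"
proof
  fix t assume t: "t \<in> {0..T}"
  define S where "S = {s \<in> {0..T}. \<not> continuous (at s within {0..T}) u}"
  have "finite S" and u_le: "\<And>s. s \<in> {0..T} \<Longrightarrow> \<bar>u s\<bar> \<le> \<nu>"
    using assms(4) by (auto simp: S_def admissible_control_def piecewise_continuous_on_def)
  have cont: "continuous_on {0..t} x" and "x 0 = x0"
    using assms(5) t by (auto simp: trajectory_def intro: continuous_on_subset)
  have deriv: "(x has_vector_derivative (A + u s *\<^sub>R B) *v x s) (at s)"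
    if s: "s \<in> {0<..<t} - S" for s
  proof -
    have "(x has_vector_derivative (A + u s *\<^sub>R B) *v x s) (at s within {0..T})"
      using assms(5) s t by (auto simp: trajectory_def S_def)
    moreover have "at s within {0..T} = at s"
      using s t by (intro at_within_interior) auto
    ultimately show ?thesis
      by simp
  qed
  have growth: "norm ((A + u s *\<^sub>R B) *v x s) \<le> \<gamma> * norm (x s)"
    if s: "s \<in> {0<..<t} - S" for s
  proof -
    have "norm (A + u s *\<^sub>R B) \<le> norm A + \<bar>u s\<bar> * norm B"
      using norm_triangle_ineq[of A "u s *\<^sub>R B"] by simp
    also have "\<dots> \<le> \<gamma>"
      using u_le[of s] s t by (auto simp: assms(3) intro: mult_right_mono)
    finally show ?thesis
      by (meson norm_matrix_vector_mult_le mult_right_mono norm_ge_zero order_trans)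
  qed
  have "0 \<le> t"
    using t by simp
  note bounds = norm_exp_bounds[OF \<open>0 \<le> t\<close> \<open>finite S\<close> cont deriv growth]
  have "\<gamma> * t \<le> \<gamma> * T"
    using t assms(2,3) by (intro mult_left_mono) auto
  then have "norm x0 * exp (- \<gamma> * T) \<le> norm x0 * exp (- \<gamma> * t)"
    and "norm x0 * exp (\<gamma> * t) \<le> norm x0 * exp (\<gamma> * T)"
    by (auto intro: mult_left_mono)
  with bounds show "norm x0 * exp (- \<gamma> * T) \<le> norm (x t) \<and> norm (x t) \<le> norm x0 * exp (\<gamma> * T)"
    unfolding \<open>x 0 = x0\<close> by linarith
qed

end
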